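(* The Kauffman bracket polynomial of a labeled graph is invariant under the graph-moves $\Omega_g2$, $\Omega_g3$, $\Omega_g4$: if $\widetilde G$ is obtained from a labeled graph $G$ by one of these moves, then $\langle\widetilde G\rangle=\langle G\rangle$.
   Context: A labeled graph is a finite simple graph $G$ (no loops, no multiple edges) in which every vertex carries a label '$+$' or '$-$' (identified with $+1,-1$). $V(G)$ is the vertex set and $N(v)$ is the set of all vertices adjacent to $v$. $A(G)$ is the adjacency matrix over $\mathbb{Z}_2$ (zero diagonal). For an $m\times m$ matrix $M$ over $\mathbb{Z}_2$, $\operatorname{corank}M=m-\operatorname{rank}M$ (the corank of the empty matrix is $0$). To change the adjacency of a pair of vertices means to join them by an edge if they are not adjacent and to delete the edge if they are adjacent. A state is any subset $s\subseteq V(G)$; $G(s)$ is the induced subgraph on $s$. Let $\alpha(s)$ be the number of vertices in $s$ labeled '$-$' plus the number of vertices in $V(G)\setminus s$ labeled '$+$', and $\beta(s)=n-\alpha(s)$ with $n=|V(G)|$. The Kauffman bracket polynomial is $$\langle G\rangle=\sum_{s\subseteq V(G)}a^{\alpha(s)-\beta(s)}(-a^2-a^{-2})^{\operatorname{corank}A(G(s))}.$$ Graph-moves. $\Omega_g2$: addition/removal of two vertices not connected by an edge, having different signs and the same adjacency with the other vertices. $\Omega_g3$: let $u,v,w$ be three vertices of $G$ all having label '$-$' such that $u$ is adjacent in $G$ only to $v$ and $w$; then change only the adjacency of $u$ with the vertices $t\in (N(v)\setminus N(w))\cup(N(w)\setminus N(v))$ (for other pairs of vertices the adjacency is not changed),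 and in addition change the labels of $v$ and $w$ to '$+$'; the inverse operation is also called $\Omega_g3$. $\Omega_g4$: take two adjacent vertices $u$ labeled $\epsilon$ and $v$ labeled $\delta$, $\epsilon,\delta\in\{\pm1\}$; change the labels so that the label of $u$ becomes $-\delta$ and the label of $v$ becomes $-\epsilon$; in addition, change the adjacency for each pair $(t,w)$ of vertices where $t\in N(u)$, $w\in N(v)\setminus N(u)$ and where $t\in N(v)$, $w\in N(u)\setminus N(v)$.
   Formalization: As printed the claim fails (path uv, uw, all labels −). In Ω_g3 the sets N(v), N(w) are taken to include v, w, so u's new neighbours are (N(v)\N(w))∪(N(w)\N(v)); in Ω_g4 t, w range over vertices other than u, v, and each unordered pair is changed once. *)

theory Defs
  imports
    "HOL-Library.Z2"
    "HOL-Library.Poly_Mapping"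
    "Jordan_Normal_Form.DL_Rank"
begin

record 'v lgraph =
  verts :: "'v set"
  edges :: "'v set set"
  label :: "'v \<Rightarrow> int"

definition labeled_graph :: "'v lgraph \<Rightarrow> bool" where
  "labeled_graph G \<longleftrightarrow>
     finite (verts G) \<and>
     edges G \<subseteq> {{x, y} | x y. x \<in> verts G \<and> y \<in> verts G \<and> x \<noteq> y} \<and>
     (\<forall>x\<in>verts G. label G x \<in> {1, -1})"

definition nbhd :: "'v lgraph \<Rightarrow> 'v \<Rightarrow> 'v set" where
  "nbhd G v = {w. {v, w} \<in> edges G}"

definition induced :: "'v lgraph \<Rightarrow> 'v set \<Rightarrow> 'v lgraph" where
  "induced G s = \<lparr>verts = s, edges = {e \<in> edges G. e \<subseteq> s}, label = label G\<rparr>"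

(* The vertices are listed in an arbitrary order to index rows and columns; a different order
   conjugates the matrix by a permutation matrix, which does not change its rank. *)
definition adjacency_matrix :: "'v lgraph \<Rightarrow> bit mat" where
  "adjacency_matrix G =
     (let xs = (SOME xs. distinct xs \<and> set xs = verts G)
      in mat (length xs) (length xs)
           (\<lambda>(i, j). if {xs ! i, xs ! j} \<in> edges G then 1 else 0))"

definition corank :: "bit mat \<Rightarrow> nat" where
  "corank M = dim_row M - vec_space.rank (dim_row M) M"

definition alpha :: "'v lgraph \<Rightarrow> 'v set \<Rightarrow> int" where
  "alpha G s = int (card {x \<in> s. label G x = -1} + card {x \<in> verts G - s. label G x = 1})"

definition beta :: "'v lgraph \<Rightarrow> 'v set \<Rightarrow> int" where
  "beta G s = int (card (verts G)) - alpha G s"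

(* Finitely supported maps from exponents to integer coefficients, with convolution as product,
   form the ring of Laurent polynomials Z[a, a^-1]. *)
type_synonym laurent = "int \<Rightarrow>\<^sub>0 int"

(* the monomial a^k *)
definition a_pow :: "int \<Rightarrow> laurent" where
  "a_pow k = Poly_Mapping.single k 1"

definition kauffman_bracket :: "'v lgraph \<Rightarrow> laurent" where
  "kauffman_bracket G =
     (\<Sum>s\<in>Pow (verts G).
        a_pow (alpha G s - beta G s) *
        (- a_pow 2 - a_pow (-2)) ^ corank (adjacency_matrix (induced G s)))"

definition change_adjacency :: "'v set set \<Rightarrow> 'v set set \<Rightarrow> 'v set set" where
  "change_adjacency E P = (E - P) \<union> (P - E)"

definition omega2_removal :: "'v lgraph \<Rightarrow> 'v lgraph \<Rightarrow> bool" where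
  "omega2_removal G H \<longleftrightarrow>
     (\<exists>u\<in>verts G. \<exists>v\<in>verts G.
        u \<noteq> v \<and> {u, v} \<notin> edges G \<and> label G u = - label G v \<and>
        (\<forall>t\<in>verts G - {u, v}. {u, t} \<in> edges G \<longleftrightarrow> {v, t} \<in> edges G) \<and>
        verts H = verts G - {u, v} \<and>
        edges H = {e \<in> edges G. e \<subseteq> verts H} \<and>
        (\<forall>x\<in>verts H. label H x = label G x))"

definition omega2 :: "'v lgraph \<Rightarrow> 'v lgraph \<Rightarrow> bool" where
  "omega2 G H \<longleftrightarrow> omega2_removal G H \<or> omega2_removal H G"

definition closed_nbhd :: "'v lgraph \<Rightarrow> 'v \<Rightarrow> 'v set" where
  "closed_nbhd G v = insert v (nbhd G v)"

(* The adjacency of u is changed with every t other than v and w lying in exactly one of N(v),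
   N(w); closed neighbourhoods fix what happens between u and v, w: if v and w are adjacent, u stays
   adjacent to both, otherwise it is disconnected from both.  Either way the set of neighbours
   of u after the move is (N(v) - N(w)) Un (N(w) - N(v)), as in the third Reidemeister move.
   With open neighbourhoods the bracket would not be invariant, e.g. for the graph with
   vertices u, v, w whose only edges are uv and uw. *)
definition omega3_forward :: "'v lgraph \<Rightarrow> 'v lgraph \<Rightarrow> bool" where
  "omega3_forward G H \<longleftrightarrow>
     (\<exists>u\<in>verts G. \<exists>v\<in>verts G. \<exists>w\<in>verts G.
        u \<noteq> v \<and> u \<noteq> w \<and> v \<noteq> w \<and>
        label G u = -1 \<and> label G v = -1 \<and> label G w = -1 \<and>
        nbhd G u = {v, w} \<and>
        verts H = verts G \<and>
        edges H = change_adjacency (edges G)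
          {{u, t} | t. t \<in> (closed_nbhd G v - closed_nbhd G w) \<union>
                           (closed_nbhd G w - closed_nbhd G v)} \<and>
        (\<forall>x\<in>verts G. label H x = (if x = v \<or> x = w then 1 else label G x)))"

definition omega3 :: "'v lgraph \<Rightarrow> 'v lgraph \<Rightarrow> bool" where
  "omega3 G H \<longleftrightarrow> omega3_forward G H \<or> omega3_forward H G"

(* The pairs {t, w} whose adjacency is changed are pairs of vertices other than u and v (which
   themselves belong to N(v) - N(u) and N(u) - N(v)); a pair is changed once even if both
   conditions apply to it. *)
definition omega4 :: "'v lgraph \<Rightarrow> 'v lgraph \<Rightarrow> bool" where
  "omega4 G H \<longleftrightarrow>
     (\<exists>u\<in>verts G. \<exists>v\<in>verts G.
        u \<noteq> v \<and> {u, v} \<in> edges G \<and>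
        verts H = verts G \<and>
        edges H = change_adjacency (edges G)
          {{t, w} | t w. t \<in> verts G - {u, v} \<and> w \<in> verts G - {u, v} \<and>
             (t \<in> nbhd G u \<and> w \<in> nbhd G v - nbhd G u \<or>
              t \<in> nbhd G v \<and> w \<in> nbhd G u - nbhd G v)} \<and>
        (\<forall>x\<in>verts G. label H x =
           (if x = u then - label G v else if x = v then - label G u else label G x)))"

end

theory Submission
  imports Defs "Jordan_Normal_Form.Matrix_Kernel"
begin

text \<open>
  Over the two-element field the corank of a symmetric matrix is determined by the number of its null
  vectors, so coranks can be compared through bijections between null spaces.  Three changes of the
  bilinear form on \<open>s\<close> are enough: adding one basis vector to others preserves the corank, an isolated
  vertex raises it by one, and two adjacent vertices can be split off by the Schur complement.

  For each move, group the states by their intersection \<open>s\<close> with the vertices \<open>V\<close> not named in the move.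
  Writing \<open>d = - a\<^sup>2 - 1/a\<^sup>2\<close>, the groups agree one by one.  For the second move, the
  twins contribute \<open>(a\<^sup>2 + 1/a\<^sup>2 + d)\<close> times the same power of \<open>d\<close>, which vanishes.  For the third, the row
  of \<open>u\<close> after the move is the sum of the rows of \<open>v\<close> and \<open>w\<close>, and the two groups match after using
  \<open>d/a = - a - 1/a\<^sup>3\<close>.  For the fourth, the move is a principal pivot on the edge \<open>uv\<close>, which exchanges
  the coranks of \<open>s\<close> and \<open>s \<union> {u, v}\<close>.
\<close>

section \<open>Kernels over finite fields\<close>

instance bit :: finite
proof
  have "(UNIV :: bit set) \<subseteq> {0, 1}"
    using bit_not_zero_iff by blast
  then show "finite (UNIV :: bit set)"
    by (rule finite_subset) simp
qed

lemma card_UNIV_bit: "card (UNIV :: bit set) = 2"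
proof -
  have "(UNIV :: bit set) = {0, 1}"
    using bit_not_zero_iff by blast
  then show ?thesis
    unfolding card_2_iff by (intro exI[of _ 0] exI[of _ 1]) simp
qed

text \<open>Coordinates with respect to a finite basis \<open>B\<close> identify the space with the
  functions from \<open>B\<close> to the scalars.\<close>

lemma (in vectorspace) card_carrier_eq_power_dim:
  assumes "fin_dim" and "finite (carrier K)"
  shows "card (carrier V) = card (carrier K) ^ dim"
proof -
  obtain B where B: "finite B" "basis B"
    using finite_basis_exists[OF assms(1)] by blast
  then have sub: "B \<subseteq> carrier V"
    by (simp add: basis_def)
  have ex1: "\<exists>!a. a \<in> B \<rightarrow>\<^sub>E carrier K \<and> lincomb a B = v" if "v \<in> carrier V" for v
    using basis_criterion[OF B(1) sub] B(2) that by blast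
  have closed: "lincomb a B \<in> carrier V" if "a \<in> B \<rightarrow>\<^sub>E carrier K" for a
    using that sub by (intro lincomb_closed) (auto simp: PiE_def)
  have "bij_betw (\<lambda>a. lincomb a B) (B \<rightarrow>\<^sub>E carrier K) (carrier V)"
    unfolding bij_betw_def inj_on_def using ex1 closed by blast
  then have "card (carrier V) = card (B \<rightarrow>\<^sub>E carrier K)"
    using bij_betw_same_card by metis
  also have "\<dots> = card (carrier K) ^ card B"
    using B(1) by (simp add: card_funcsetE)
  finally show ?thesis
    using dim_basis[OF B] by simp
qed

lemma card_carrier_vec:
  "card (carrier_vec n :: 'a::finite vec set) = card (UNIV :: 'a set) ^ n"
proof -
  have "bij_betw vec_of_list {xs :: 'a list. set xs \<subseteq> UNIV \<and> length xs = n} (carrier_vec n)"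
  proof (rule bij_betwI[where g = list_of_vec])
    show "list_of_vec \<in> (carrier_vec n :: 'a vec set) \<rightarrow> {xs. set xs \<subseteq> UNIV \<and> length xs = n}"
      by (intro funcsetI) (use carrier_vecD in simp)
    show "vec_of_list \<in> {xs :: 'a list. set xs \<subseteq> UNIV \<and> length xs = n} \<rightarrow> carrier_vec n"
      by (intro funcsetI carrier_vecI) simp
  qed (rule list_vec vec_list)+
  then show ?thesis
    using card_lists_length_eq[of "UNIV :: 'a set" n] by (simp add: bij_betw_same_card)
qed

text \<open>Rank-nullity in counting form: each nonempty fibre of \<open>A\<close> is a translate of
  the kernel, so all these fibres have the same size.\<close>

lemma card_mat_kernel_times_image:
  fixes A :: "'a::{field,finite} mat"
  assumes A: "A \<in> carrier_mat nr nc"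
  shows "card (mat_kernel A) * card ((*\<^sub>v) A ` carrier_vec nc) = card (UNIV :: 'a set) ^ nc"
proof -
  have fin: "finite (carrier_vec nc :: 'a vec set)"
    by (rule card_ge_0_finite) (simp add: card_carrier_vec finite_UNIV_card_ge_0)
  have fibre: "card {v \<in> carrier_vec nc. A *\<^sub>v v = y} = card (mat_kernel A)"
    if y: "y \<in> (*\<^sub>v) A ` carrier_vec nc" for y
  proof -
    obtain w where w: "w \<in> carrier_vec nc" "y = A *\<^sub>v w"
      using y by blast
    have "bij_betw (\<lambda>v. v - w) {v \<in> carrier_vec nc. A *\<^sub>v v = y} (mat_kernel A)"
      using A w
      by (intro bij_betwI[where g = "\<lambda>v. v + w"])
        (auto simp: mat_kernel[OF A] mult_minus_distrib_mat_vec mult_add_distrib_mat_vec)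
    then show ?thesis
      by (rule bij_betw_same_card)
  qed
  have "card (UNIV :: 'a set) ^ nc = (\<Sum>y\<in>(*\<^sub>v) A ` carrier_vec nc. card {v \<in> carrier_vec nc. A *\<^sub>v v = y})"
    using sum.image_gen[OF fin, of "\<lambda>_. 1::nat" "(*\<^sub>v) A"] by (simp add: card_carrier_vec)
  also have "\<dots> = card ((*\<^sub>v) A ` carrier_vec nc) * card (mat_kernel A)"
    using fibre by simp
  finally show ?thesis by (simp add: mult.commute)
qed

text \<open>The image is the column space, of dimension \<open>rank A\<close>; cancelling its size
  from the fibre count leaves the kernel. For square \<open>A\<close> the exponent is the
  corank.\<close>

lemma card_mat_kernel:
  fixes A :: "'a::{field,finite} mat"
  assumes A: "A \<in> carrier_mat n nc"
  shows "card (mat_kernel A) = card (UNIV :: 'a set) ^ (nc - vec_space.rank n A)"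
proof -
  interpret vec_space "TYPE('a)" n .
  have sub: "set (cols A) \<subseteq> carrier_vec n"
    using cols_dim A by blast
  interpret W: vectorspace class_ring "vs (span (set (cols A)))"
    using sub by (intro subspace_is_vs span_is_subspace) simp
  have "(*\<^sub>v) A ` carrier_vec nc = span (set (cols A))"
    using col_space_eq[OF A] A unfolding col_space_def by auto
  moreover have "card (span (set (cols A))) = card (UNIV :: 'a set) ^ rank A"
    using W.card_carrier_eq_power_dim fin_dim_span_cols[OF A]
    by (simp add: rank_def class_ring_simps)
  ultimately have "card (mat_kernel A) * card (UNIV :: 'a set) ^ rank A = card (UNIV :: 'a set) ^ nc"
    using card_mat_kernel_times_image[OF A] by simp
  also have "\<dots> = card (UNIV :: 'a set) ^ (nc - rank A) * card (UNIV :: 'a set) ^ rank A"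
    using rank_le_nc[OF A] by (simp flip: power_add)
  finally show ?thesis by simp
qed

section \<open>Null vectors of a bilinear form\<close>

text \<open>The kernel of the matrix of \<open>E\<close> on \<open>S\<close>, without an order on
  \<open>S\<close>. The value 0 off \<open>S\<close> makes each kernel vector a single function, so
  that counting is meaningful.\<close>

definition null_vectors :: "('v \<Rightarrow> 'v \<Rightarrow> 'a::field) \<Rightarrow> 'v set \<Rightarrow> ('v \<Rightarrow> 'a) set" where
  "null_vectors E S = {f. (\<forall>x. x \<notin> S \<longrightarrow> f x = 0) \<and> (\<forall>x\<in>S. (\<Sum>y\<in>S. E x y * f y) = 0)}"

lemma null_vectors_cong:
  assumes "\<And>x y. x \<in> S \<Longrightarrow> y \<in> S \<Longrightarrow> E x y = F x y"
  shows "null_vectors E S = null_vectors F S"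
  using assms by (simp add: null_vectors_def cong: sum.cong)

text \<open>Serves two purposes: passing from vertices to matrix indices, and renaming one vertex to
  another.\<close>

lemma card_null_vectors_image:
  assumes "inj_on h S"
  shows "card (null_vectors E (h ` S)) = card (null_vectors (\<lambda>x y. E (h x) (h y)) S)"
proof -
  have "bij_betw (\<lambda>f x. if x \<in> S then f (h x) else 0)
          (null_vectors E (h ` S)) (null_vectors (\<lambda>x y. E (h x) (h y)) S)"
  proof (rule bij_betwI[where g = "\<lambda>f z. if z \<in> h ` S then f (the_inv_into S h z) else 0"])
    show "(\<lambda>f x. if x \<in> S then f (h x) else 0)
        \<in> null_vectors E (h ` S) \<rightarrow> null_vectors (\<lambda>x y. E (h x) (h y)) S"
      using assms by (auto simp: null_vectors_def sum.reindex)
    show "(\<lambda>f z. if z \<in> h ` S then f (the_inv_into S h z) else 0)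
        \<in> null_vectors (\<lambda>x y. E (h x) (h y)) S \<rightarrow> null_vectors E (h ` S)"
      using assms by (auto simp: null_vectors_def sum.reindex the_inv_into_f_f)
  next
    fix f assume "f \<in> null_vectors E (h ` S)"
    then show "(\<lambda>z. if z \<in> h ` S then (\<lambda>x. if x \<in> S then f (h x) else 0) (the_inv_into S h z) else 0) = f"
      using assms by (auto simp: null_vectors_def fun_eq_iff the_inv_into_f_f)
  next
    fix f assume "f \<in> null_vectors (\<lambda>x y. E (h x) (h y)) S"
    then show "(\<lambda>x. if x \<in> S then (\<lambda>z. if z \<in> h ` S then f (the_inv_into S h z) else 0) (h x) else 0) = f"
      using assms by (auto simp: null_vectors_def fun_eq_iff the_inv_into_f_f)
  qed
  then show ?thesis by (rule bij_betw_same_card)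
qed

text \<open>\<open>F\<close> is \<open>E\<close> in the basis where each vector \<open>x\<close> is
  replaced by \<open>x + c x * u\<close>; \<open>c u = 0\<close> makes this change invertible. On
  coordinates it adds the sum of all \<open>c y * f y\<close> to \<open>f u\<close>.\<close>

lemma card_null_vectors_congruence:
  assumes fin: "finite S" and u: "u \<in> S" and c: "c u = 0"
    and F: "\<And>x y. x \<in> S \<Longrightarrow> y \<in> S \<Longrightarrow>
              F x y = E x y + c x * E u y + E x u * c y + c x * c y * E u u"
  shows "card (null_vectors F S) = card (null_vectors E S)"
proof -
  define C where "C f = (\<Sum>y\<in>S. c y * f y)" for f
  \<comment> \<open>As \<open>c u = 0\<close>, the value of \<open>C\<close> does not see coordinate
    \<open>u\<close>; hence subtracting \<open>C f\<close> there undoes adding it.\<close>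
  have C_upd: "C (f(u := t)) = C f" for f t
    unfolding C_def using c by (intro sum.cong) auto
  have sum_upd: "(\<Sum>y\<in>S. E x y * (f(u := f u + t)) y) = (\<Sum>y\<in>S. E x y * f y) + E x u * t" for f t x
    using fin u by (simp add: sum.remove[of S u] algebra_simps)
  have sum_F: "(\<Sum>y\<in>S. F x y * f y) =
      (\<Sum>y\<in>S. E x y * (f(u := f u + C f)) y) + c x * (\<Sum>y\<in>S. E u y * (f(u := f u + C f)) y)"
    if "x \<in> S" for f x
  proof -
    have "(\<Sum>y\<in>S. F x y * f y) = (\<Sum>y\<in>S. E x y * f y + c x * (E u y * f y)
        + E x u * (c y * f y) + c x * E u u * (c y * f y))"
      using that F by (intro sum.cong) (auto simp: algebra_simps)
    also have "\<dots> = (\<Sum>y\<in>S. E x y * f y) + c x * (\<Sum>y\<in>S. E u y * f y) + E x u * C f + c x * E u u * C f"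
      by (simp add: sum.distrib sum_distrib_left C_def)
    finally show ?thesis
      unfolding sum_upd by (simp add: algebra_simps)
  qed
  have mem: "f(u := f u + C f) \<in> null_vectors E S \<longleftrightarrow> f \<in> null_vectors F S" for f
  proof -
    have "(\<forall>x\<in>S. (\<Sum>y\<in>S. F x y * f y) = 0) \<longleftrightarrow>
        (\<forall>x\<in>S. (\<Sum>y\<in>S. E x y * (f(u := f u + C f)) y) = 0)" (is "?F \<longleftrightarrow> ?E")
    proof
      assume ?F
      \<comment> \<open>At \<open>x = u\<close> the factor \<open>c x\<close> vanishes, so
        \<open>sum_F\<close> gives the bare row \<open>u\<close> of \<open>E\<close>. Once that row
        is 0, its multiples drop out of all other rows.\<close>
      then have "(\<Sum>y\<in>S. E u y * (f(u := f u + C f)) y) = 0"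
        using sum_F[OF u, of f] u c by simp
      then show ?E using \<open>?F\<close> sum_F[of _ f] by simp
    next
      assume ?E
      then show ?F using sum_F u by simp
    qed
    moreover have "(\<forall>x. x \<notin> S \<longrightarrow> (f(u := f u + C f)) x = 0) \<longleftrightarrow> (\<forall>x. x \<notin> S \<longrightarrow> f x = 0)"
      using u by auto
    ultimately show ?thesis
      unfolding null_vectors_def by blast
  qed
  have "bij_betw (\<lambda>f. f(u := f u + C f)) (null_vectors F S) (null_vectors E S)"
  proof (rule bij_betwI[where g = "\<lambda>f. f(u := f u - C f)"])
    show "(\<lambda>f. f(u := f u + C f)) \<in> null_vectors F S \<rightarrow> null_vectors E S"
      using mem by blast
    show "(\<lambda>f. f(u := f u - C f)) \<in> null_vectors E S \<rightarrow> null_vectors F S"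
    proof
      fix f assume "f \<in> null_vectors E S"
      then show "f(u := f u - C f) \<in> null_vectors F S"
        using mem[of "f(u := f u - C f)"] by (simp add: C_upd)
    qed
  qed (simp_all add: C_upd)
  then show ?thesis by (rule bij_betw_same_card)
qed

text \<open>Rows \<open>u\<close> and \<open>v\<close> determine \<open>f v\<close> and
  \<open>f u\<close> from the other coordinates. Substituting these values into the remaining rows
  gives the Schur complement \<open>F\<close>.\<close>

lemma card_null_vectors_pivot:
  assumes fin: "finite S" and uv: "u \<noteq> v" "u \<notin> S" "v \<notin> S"
    and E: "E u u = 0" "E v v = 0" "E u v = 1" "E v u = 1"
    and F: "\<And>x y. x \<in> S \<Longrightarrow> y \<in> S \<Longrightarrow> F x y = E x y - E x u * E v y - E x v * E u y"
  shows "card (null_vectors E (insert u (insert v S))) = card (null_vectors F S)"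
proof -
  define R where "R x f = (\<Sum>y\<in>S. E x y * f y)" for x f
  \<comment> \<open>\<open>R\<close> sums over \<open>S\<close> only, so the coordinates at
    \<open>u\<close> and \<open>v\<close> can be erased and refilled without changing it.\<close>
  have R_upd: "R x (f(u := s, v := t)) = R x f" for x f s t
    unfolding R_def using uv by (intro sum.cong) auto
  have sum_uv: "(\<Sum>y\<in>insert u (insert v S). E x y * f y) = E x u * f u + E x v * f v + R x f" for x f
    using fin uv by (simp add: R_def)
  have sum_F: "(\<Sum>y\<in>S. F x y * f y) = R x f - E x u * R v f - E x v * R u f" if "x \<in> S" for x f
  proof -
    have "(\<Sum>y\<in>S. F x y * f y) = (\<Sum>y\<in>S. E x y * f y - E x u * (E v y * f y) - E x v * (E u y * f y))"
      by (intro sum.cong refl) (simp add: F that left_diff_distrib mult.assoc)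
    then show ?thesis
      by (simp add: sum_subtractf sum_distrib_left R_def)
  qed
  have mem_E: "f \<in> null_vectors E (insert u (insert v S)) \<longleftrightarrow>
      (\<forall>x. x \<notin> insert u (insert v S) \<longrightarrow> f x = 0) \<and> f v = - R u f \<and> f u = - R v f \<and>
      (\<forall>x\<in>S. E x u * f u + E x v * f v + R x f = 0)" for f
    unfolding null_vectors_def sum_uv by (auto simp: E eq_neg_iff_add_eq_0)
  have mem_F: "f \<in> null_vectors F S \<longleftrightarrow> (\<forall>x. x \<notin> S \<longrightarrow> f x = 0) \<and>
      (\<forall>x\<in>S. R x f - E x u * R v f - E x v * R u f = 0)" for f
    unfolding null_vectors_def by (auto simp: sum_F)
  have "bij_betw (\<lambda>f. f(u := 0, v := 0)) (null_vectors E (insert u (insert v S))) (null_vectors F S)"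
  proof (rule bij_betwI[where g = "\<lambda>f. f(u := - R v f, v := - R u f)"])
    show "(\<lambda>f. f(u := 0, v := 0)) \<in> null_vectors E (insert u (insert v S)) \<rightarrow> null_vectors F S"
    proof
      fix f assume f: "f \<in> null_vectors E (insert u (insert v S))"
      then have "R x f - E x u * R v f - E x v * R u f = 0" if "x \<in> S" for x
        using that unfolding mem_E by (auto simp: algebra_simps)
      then show "f(u := 0, v := 0) \<in> null_vectors F S"
        using f unfolding mem_E mem_F R_upd by auto
    qed
    show "(\<lambda>f. f(u := - R v f, v := - R u f)) \<in> null_vectors F S \<rightarrow> null_vectors E (insert u (insert v S))"
    proof
      fix f assume f: "f \<in> null_vectors F S"
      then have "E x u * (- R v f) + E x v * (- R u f) + R x f = 0" if "x \<in> S" for x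
        using that unfolding mem_F by (auto simp: algebra_simps)
      then show "f(u := - R v f, v := - R u f) \<in> null_vectors E (insert u (insert v S))"
        using f uv unfolding mem_E mem_F R_upd by auto
    qed
  next
    fix f assume "f \<in> null_vectors E (insert u (insert v S))"
    then show "(f(u := 0, v := 0))(u := - R v (f(u := 0, v := 0)), v := - R u (f(u := 0, v := 0))) = f"
      unfolding mem_E R_upd by (auto simp: fun_eq_iff)
  next
    fix f assume "f \<in> null_vectors F S"
    then show "(f(u := - R v f, v := - R u f))(u := 0, v := 0) = f"
      using uv unfolding mem_F by (auto simp: fun_eq_iff)
  qed
  then show ?thesis by (rule bij_betw_same_card)
qed

text \<open>The row of \<open>u\<close> is vacuous and no other row involves \<open>f u\<close>, so
  this coordinate ranges freely over the field.\<close>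

lemma card_null_vectors_isolated:
  fixes E :: "'v \<Rightarrow> 'v \<Rightarrow> 'a::field"
  assumes fin: "finite S" and u: "u \<notin> S"
    and E: "\<And>x. x \<in> insert u S \<Longrightarrow> E u x = 0" "\<And>x. x \<in> insert u S \<Longrightarrow> E x u = 0"
  shows "card (null_vectors E (insert u S)) = card (UNIV :: 'a set) * card (null_vectors E S)"
proof -
  have upd: "(\<Sum>y\<in>S. E x y * (if y = u then t else f y)) = (\<Sum>y\<in>S. E x y * f y)" for f t x
    using u by (intro sum.cong) auto
  have mem: "f \<in> null_vectors E (insert u S) \<longleftrightarrow> f(u := 0) \<in> null_vectors E S" for f
    using fin u E by (auto simp: null_vectors_def upd)
  have "bij_betw (\<lambda>f. (f u, f(u := 0))) (null_vectors E (insert u S)) (UNIV \<times> null_vectors E S)"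
  proof (rule bij_betwI[where g = "\<lambda>(a, f). f(u := a)"])
    show "(\<lambda>f. (f u, f(u := 0))) \<in> null_vectors E (insert u S) \<rightarrow> UNIV \<times> null_vectors E S"
      using mem by blast
    have id: "f(u := 0) = f" if "f \<in> null_vectors E S" for f
      using that u by (auto simp: null_vectors_def fun_eq_iff)
    show "(\<lambda>(a, f). f(u := a)) \<in> UNIV \<times> null_vectors E S \<rightarrow> null_vectors E (insert u S)"
      using mem id by auto
    show "(\<lambda>f. (f u, f(u := 0))) ((\<lambda>(a, f). f(u := a)) p) = p" if "p \<in> UNIV \<times> null_vectors E S" for p
      using that id by auto
  qed simp
  then show ?thesis
    by (simp add: bij_betw_same_card card_cartesian_product)
qed

text \<open>The enumeration is chosen as in the adjacency matrix, so that both matrices agree entrywise.\<close>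

definition nullity :: "('v \<Rightarrow> 'v \<Rightarrow> bit) \<Rightarrow> 'v set \<Rightarrow> nat" where
  "nullity E S =
     (let xs = (SOME xs. distinct xs \<and> set xs = S)
      in corank (mat (length xs) (length xs) (\<lambda>(i, j). E (xs ! i) (xs ! j))))"

lemma card_null_vectors_mat:
  fixes M :: "nat \<Rightarrow> nat \<Rightarrow> 'a::field"
  shows "card (null_vectors M {..<n}) = card (mat_kernel (mat n n (\<lambda>(i, j). M i j)))"
proof -
  let ?A = "mat n n (\<lambda>(i, j). M i j)"
  have mult: "(?A *\<^sub>v vec n f) = vec n (\<lambda>i. \<Sum>j<n. M i j * f j)" for f
    by (rule eq_vecI) (simp_all add: scalar_prod_def atLeast0LessThan)
  have ker: "vec n f \<in> mat_kernel ?A \<longleftrightarrow> (\<forall>i<n. (\<Sum>j<n. M i j * f j) = 0)" for f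
    unfolding mat_kernel[OF mat_carrier] mem_Collect_eq mult by (simp add: vec_eq_iff)
  have "bij_betw (vec n) (null_vectors M {..<n}) (mat_kernel ?A)"
  \<comment> \<open>Entries of \<open>v\<close> beyond its dimension carry no meaning; they are
    replaced by the 0 that \<open>null_vectors\<close> prescribes.\<close>
  proof (rule bij_betwI[where g = "\<lambda>v i. if i < n then v $ i else 0"])
    show "vec n \<in> null_vectors M {..<n} \<rightarrow> mat_kernel ?A"
      using ker by (auto simp: null_vectors_def)
    have "vec n (\<lambda>i. if i < n then v $ i else 0) = v" if "v \<in> mat_kernel ?A" for v
    proof -
      have "dim_vec v = n"
        using that unfolding mat_kernel[OF mat_carrier] by (auto dest: carrier_vecD)
      then show ?thesis by (intro eq_vecI) auto
    qed
    note vec_n = this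
    show "vec n (\<lambda>i. if i < n then v $ i else 0) = v" if "v \<in> mat_kernel ?A" for v
      using that by (rule vec_n)
    show "(\<lambda>v i. if i < n then v $ i else 0) \<in> mat_kernel ?A \<rightarrow> null_vectors M {..<n}"
    proof
      fix v assume "v \<in> mat_kernel ?A"
      then have "\<forall>i<n. (\<Sum>j<n. M i j * (if j < n then v $ j else 0)) = 0"
        using ker[of "\<lambda>i. if i < n then v $ i else 0"] by (simp only: vec_n)
      then show "(\<lambda>i. if i < n then v $ i else 0) \<in> null_vectors M {..<n}"
        by (simp add: null_vectors_def)
    qed
    show "(\<lambda>i. if i < n then vec n f $ i else 0) = f" if "f \<in> null_vectors M {..<n}" for f
      using that by (simp add: null_vectors_def fun_eq_iff)
  qed
  then show ?thesis by (rule bij_betw_same_card)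
qed

text \<open>The bridge from counting to corank: as powers of 2 are injective in the exponent, equal
  counts give equal coranks.\<close>

lemma card_null_vectors_nullity:
  assumes "finite S"
  shows "card (null_vectors E S) = 2 ^ nullity E S"
proof -
  define xs where "xs = (SOME xs. distinct xs \<and> set xs = S)"
  have xs: "distinct xs \<and> set xs = S"
    unfolding xs_def using finite_distinct_list[OF assms]
    by (intro someI_ex[where P = "\<lambda>xs. distinct xs \<and> set xs = S"]) (elim exE conjE, intro exI conjI)
  let ?n = "length xs"
  let ?M = "mat ?n ?n (\<lambda>(i, j). E (xs ! i) (xs ! j))"
  have inj: "inj_on ((!) xs) {..<?n}"
    using xs by (intro inj_on_nth) auto
  have image: "(!) xs ` {..<?n} = S"
    using xs by (auto simp: set_conv_nth)
  have "card (null_vectors E S) = card (mat_kernel ?M)"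
    using card_null_vectors_image[OF inj, of E] unfolding image card_null_vectors_mat .
  also have "\<dots> = 2 ^ (?n - vec_space.rank ?n ?M)"
    using card_mat_kernel[OF mat_carrier, of ?n ?n "\<lambda>(i, j). E (xs ! i) (xs ! j)"] card_UNIV_bit by argo
  also have "?n - vec_space.rank ?n ?M = nullity E S"
    unfolding nullity_def xs_def[symmetric] Let_def corank_def by simp
  finally show ?thesis .
qed

section \<open>Rules for coranks obtained from counting null vectors\<close>

lemma nullity_eqI:
  assumes "finite S" "finite T" "card (null_vectors E S) = card (null_vectors F T)"
  shows "nullity E S = nullity F T"
  using assms by (simp add: card_null_vectors_nullity)

lemma nullity_cong:
  assumes "finite S" "\<And>x y. x \<in> S \<Longrightarrow> y \<in> S \<Longrightarrow> E x y = F x y"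
  shows "nullity E S = nullity F S"
proof (rule nullity_eqI)
  show "card (null_vectors E S) = card (null_vectors F S)"
    using null_vectors_cong[of S E F] assms(2) by simp
qed (rule assms(1))+

lemma nullity_image:
  assumes "finite S" "inj_on h S"
  shows "nullity E (h ` S) = nullity (\<lambda>x y. E (h x) (h y)) S"
  using assms by (intro nullity_eqI card_null_vectors_image) simp_all

lemma nullity_congruence:
  assumes "finite S" "u \<in> S" "c u = 0"
    and "\<And>x y. x \<in> S \<Longrightarrow> y \<in> S \<Longrightarrow>
           F x y = E x y + c x * E u y + E x u * c y + c x * c y * E u u"
  shows "nullity F S = nullity E S"
  using card_null_vectors_congruence[of S u c F E] assms by (intro nullity_eqI) auto

text \<open>The Schur complement with plus signs, since subtraction is addition over
  \<open>bit\<close>.\<close>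

lemma nullity_pivot:
  assumes "finite S" "u \<noteq> v" "u \<notin> S" "v \<notin> S"
    and "E u u = 0" "E v v = 0" "E u v = 1" "E v u = 1"
    and "\<And>x y. x \<in> S \<Longrightarrow> y \<in> S \<Longrightarrow> F x y = E x y + E x u * E v y + E x v * E u y"
  shows "nullity E (insert u (insert v S)) = nullity F S"
  using card_null_vectors_pivot[of S u v E F] assms by (intro nullity_eqI) (auto simp del: add_bit_eq_xor)

lemma nullity_isolated:
  assumes "finite S" "u \<notin> S"
    and "\<And>x. x \<in> insert u S \<Longrightarrow> E u x = 0" "\<And>x. x \<in> insert u S \<Longrightarrow> E x u = 0"
  shows "nullity E (insert u S) = Suc (nullity E S)"
proof -
  have "(2::nat) ^ nullity E (insert u S) = 2 ^ Suc (nullity E S)"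
    using card_null_vectors_isolated[of S u E] assms
    by (simp add: card_UNIV_bit flip: card_null_vectors_nullity)
  then show ?thesis
    by (rule power_inject_exp[THEN iffD1, rotated]) simp
qed

section \<open>Coranks under the moves\<close>

declare add_bit_eq_xor [simp del] mult_bit_eq_and [simp del]

text \<open>Characteristic two as rewrite rules: equal summands cancel once \<open>ac_simps\<close>
  has brought them together.\<close>

lemma bit_add_self [simp]: "a + a = (0::bit)" "a + (a + b) = (b::bit)"
  by (cases a; cases b; simp)+

text \<open>Adding the basis vector of \<open>v\<close> to that of \<open>u\<close> cancels every
  entry in the row and column of \<open>u\<close>, which leaves \<open>u\<close> isolated.\<close>

lemma nullity_twins:
  assumes fin: "finite S" and uv: "u \<noteq> v" "u \<notin> S" "v \<notin> S"
    and E: "E u u = 0" "E v v = 0" "E u v = 0" "E v u = 0"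
    and twins: "\<And>x. x \<in> S \<Longrightarrow> E u x = E v x" "\<And>x. x \<in> S \<Longrightarrow> E x u = E x v"
  shows "nullity E (insert u (insert v S)) = Suc (nullity E (insert v S))"
proof -
  define c where "c x = (if x = u then 1 else 0 :: bit)" for x
  define F where "F x y = E x y + c x * E v y + E x v * c y + c x * c y * E v v" for x y
  have "nullity E (insert u (insert v S)) = nullity F (insert u (insert v S))"
    using fin uv by (intro nullity_congruence[symmetric, where u = v and c = c]) (auto simp: F_def c_def)
  also have "\<dots> = Suc (nullity F (insert v S))"
    using fin uv E twins by (intro nullity_isolated) (auto simp: F_def c_def)
  also have "nullity F (insert v S) = nullity E (insert v S)"
    using fin uv by (intro nullity_cong) (auto simp: F_def c_def)
  finally show ?thesis .
qed

text \<open>Either twin can be taken as the redundant one in \<open>nullity_twins\<close>, and the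
  full set is the same in both cases.\<close>

lemma nullity_swap_twins:
  assumes "finite S" "u \<noteq> v" "u \<notin> S" "v \<notin> S"
    and "E u u = 0" "E v v = 0" "E u v = 0" "E v u = 0"
    and "\<And>x. x \<in> S \<Longrightarrow> E u x = E v x" "\<And>x. x \<in> S \<Longrightarrow> E x u = E x v"
  shows "nullity E (insert u S) = nullity E (insert v S)"
  using nullity_twins[of S u v E] nullity_twins[of S v u E] assms by (simp add: insert_commute)

section \<open>Coranks for the third move: \<open>E\<close> before, \<open>F\<close> after,
  \<open>S\<close> the unnamed vertices of the state\<close>

context
  fixes E F :: "'v \<Rightarrow> 'v \<Rightarrow> bit" and u v w :: 'v and S :: "'v set"
  assumes fin: "finite S"
    and notin: "u \<notin> S" "v \<notin> S" "w \<notin> S" and distinct: "u \<noteq> v" "u \<noteq> w" "v \<noteq> w"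
    and sym: "\<And>x y. E x y = E y x" "\<And>x y. F x y = F y x"
    and diag: "\<And>x. E x x = 0" "\<And>x. F x x = 0"
    and E_u: "E u v = 1" "E u w = 1" "\<And>x. x \<in> S \<Longrightarrow> E u x = 0"
    and F_u: "\<And>x. x \<in> insert v (insert w S) \<Longrightarrow> F u x = E v x + E w x"
    and F_E: "\<And>x y. x \<in> insert v (insert w S) \<Longrightarrow> y \<in> insert v (insert w S) \<Longrightarrow> F x y = E x y"
begin

private lemma E_u': "E v u = 1" "E w u = 1" "\<And>x. x \<in> S \<Longrightarrow> E x u = 0"
  using E_u sym(1)[of _ u] by simp_all

private lemma F_u': "x \<in> insert v (insert w S) \<Longrightarrow> F x u = E v x + E w x"
  using F_u sym(2)[of x u] by simp

private lemma E_vw: "E w v = E v w" "\<And>x. x \<in> S \<Longrightarrow> E x v = E v x" "\<And>x. x \<in> S \<Longrightarrow> E x w = E w x"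
  by (rule sym)+

text \<open>Before the move \<open>u\<close> sees only \<open>v\<close> and \<open>w\<close>, so it
  is isolated in their absence.\<close>

lemma triangle_E_u: "nullity E (insert u S) = Suc (nullity E S)"
  using fin notin diag E_u E_u' by (intro nullity_isolated) auto

text \<open>Pivot on the edge \<open>uv\<close>: each correction term has a factor
  \<open>E x u\<close> or \<open>E u y\<close>, which is 0 on \<open>S\<close>.\<close>

lemma triangle_E_uv: "nullity E (insert u (insert v S)) = nullity E S"
  using fin notin distinct diag E_u E_u' by (intro nullity_pivot) auto

text \<open>Pivoting on \<open>uv\<close> adds the row of \<open>v\<close> to that of
  \<open>w\<close>, and this sum is the row of \<open>u\<close> after the move. The remaining vertex
  \<open>w\<close> thus acts as \<open>u\<close> does in \<open>F\<close>; \<open>h\<close> performs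
  the renaming.\<close>

lemma triangle_E_uvw: "nullity E (insert u (insert v (insert w S))) = nullity F (insert u S)"
proof -
  define h where "h x = (if x = w then u else x)" for x
  have h: "h ` insert w S = insert u S" "inj_on h (insert w S)"
    using notin by (auto simp: h_def inj_on_def)
  have "nullity F (h ` insert w S) = nullity (\<lambda>x y. F (h x) (h y)) (insert w S)"
    using fin h(2) by (intro nullity_image) auto
  moreover have "nullity E (insert u (insert v (insert w S))) = nullity (\<lambda>x y. F (h x) (h y)) (insert w S)"
  proof (rule nullity_pivot)
    fix x y assume "x \<in> insert w S" "y \<in> insert w S"
    then show "F (h x) (h y) = E x y + E x u * E v y + E x v * E u y"
      using notin distinct diag E_u E_u' F_u F_u' F_E E_vw
      by (auto simp: h_def ac_simps)
  qed (use fin notin distinct diag E_u E_u' in auto)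
  ultimately show ?thesis
    using h(1) by simp
qed

private definition "c x = (if x = u then 1 else 0 :: bit)"

text \<open>Adding the basis vector of \<open>v\<close> to that of \<open>u\<close> turns \<open>u\<close> into a twin of \<open>w\<close>.\<close>

private definition "F' x y = F x y + c x * F v y + F x v * c y + c x * c y * F v v"

text \<open>The row of \<open>v\<close> cancels the summand \<open>E v x\<close> of
  \<open>F u x\<close>.\<close>

private lemma F'_u:
  "x \<in> insert v (insert w S) \<Longrightarrow> F' u x = E w x" "x \<in> insert v (insert w S) \<Longrightarrow> F' x u = E w x"
  "F' u u = 0"
  using notin distinct diag F_u F_u' F_E E_vw
  by (auto simp: F'_def c_def ac_simps)

private lemma F'_E:
  "x \<in> insert v (insert w S) \<Longrightarrow> y \<in> insert v (insert w S) \<Longrightarrow> F' x y = E x y"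
  using notin distinct F_E by (auto simp: F'_def c_def)

text \<open>The basis vector being added is that of \<open>v\<close>, so \<open>v\<close> has to lie
  in the set.\<close>

private lemma nullity_F':
  "finite T \<Longrightarrow> v \<in> T \<Longrightarrow> nullity F T = nullity F' T"
  using distinct by (intro nullity_congruence[symmetric, where u = v and c = c]) (auto simp: F'_def c_def)

private lemma F'_twins:
  "finite (insert v S)" "u \<noteq> w" "u \<notin> insert v S" "w \<notin> insert v S"
  "F' u u = 0" "F' w w = 0" "F' u w = 0" "F' w u = 0"
  "\<And>x. x \<in> insert v S \<Longrightarrow> F' u x = F' w x" "\<And>x. x \<in> insert v S \<Longrightarrow> F' x u = F' x w"
  using fin notin distinct diag F'_u F'_E E_vw by auto

private lemma nullity_F'_E: "nullity F' (insert w (insert v S)) = nullity E (insert v (insert w S))"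
  using fin F'_E by (subst insert_commute) (intro nullity_cong, auto)

text \<open>After the change of basis \<open>u\<close> can be exchanged for its twin
  \<open>w\<close>, and away from \<open>u\<close> the forms \<open>F'\<close> and \<open>E\<close>
  agree.\<close>

lemma triangle_F_uv: "nullity F (insert u (insert v S)) = nullity E (insert v (insert w S))"
  using nullity_swap_twins[of "insert v S" u w F', OF F'_twins] nullity_F'_E fin
  by (simp add: nullity_F')

text \<open>Here both twins are present, and the second one adds a dimension to the null
  space.\<close>

lemma triangle_F_uvw:
  "nullity F (insert u (insert v (insert w S))) = Suc (nullity E (insert v (insert w S)))"
  using nullity_twins[of "insert v S" u w F', OF F'_twins] nullity_F'_E fin
  by (simp add: nullity_F' insert_commute)

end

section \<open>Coranks for the fourth move: \<open>F\<close> is the pivot of \<open>E\<close> on the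
  edge \<open>uv\<close>\<close>

context
  fixes E F :: "'v \<Rightarrow> 'v \<Rightarrow> bit" and u v :: 'v and S :: "'v set"
  assumes fin: "finite S" and notin: "u \<notin> S" "v \<notin> S" and distinct: "u \<noteq> v"
    and sym: "\<And>x y. E x y = E y x" "\<And>x y. F x y = F y x"
    and diag: "\<And>x. E x x = 0" "\<And>x. F x x = 0"
    and E_uv: "E u v = 1"
    and F_u: "\<And>x. x \<in> insert v S \<Longrightarrow> F u x = E u x"
    and F_v: "\<And>x. x \<in> insert u S \<Longrightarrow> F v x = E v x"
    and F_E: "\<And>x y. x \<in> S \<Longrightarrow> y \<in> S \<Longrightarrow> F x y = E x y + E x u * E v y + E x v * E u y"
begin

private lemma E_comm: "E v u = 1" "\<And>x. x \<in> S \<Longrightarrow> E x u = E u x" "\<And>x. x \<in> S \<Longrightarrow> E x v = E v x"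
  using E_uv sym(1)[of v u] by simp (rule sym)+

private lemma F_comm: "F v u = 1" "F u v = 1" "\<And>x. x \<in> S \<Longrightarrow> F x u = E u x" "\<And>x. x \<in> S \<Longrightarrow> F x v = E v x"
proof -
  show "F u v = 1" using E_uv F_u by simp
  then show "F v u = 1" by (subst sym(2))
  show "F x u = E u x" if "x \<in> S" for x
    by (subst sym(2)) (simp add: F_u that)
  show "F x v = E v x" if "x \<in> S" for x
    by (subst sym(2)) (simp add: F_v that)
qed

lemma pivot_E_uv: "nullity E (insert u (insert v S)) = nullity F S"
  using fin notin distinct diag E_uv E_comm F_E by (intro nullity_pivot) auto

text \<open>Pivoting is an involution: the rows of \<open>u\<close> and \<open>v\<close> stay fixed,
  so the second pivot adds the same correction again and it cancels.\<close>

lemma pivot_F_uv: "nullity F (insert u (insert v S)) = nullity E S"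
proof (rule nullity_pivot)
  fix x y assume "x \<in> S" "y \<in> S"
  then show "E x y = F x y + F x u * F v y + F x v * F u y"
    using F_u F_v F_E E_comm F_comm
    by (simp add: ac_simps)
qed (use fin notin distinct diag F_comm in auto)

text \<open>Adding the basis vector of \<open>u\<close> to each neighbour of \<open>v\<close> in
  \<open>S\<close> yields the same correction as the pivot; the quadratic term dies because
  \<open>E u u = 0\<close>.\<close>

lemma pivot_u: "nullity F (insert u S) = nullity E (insert u S)"
\<comment> \<open>Since \<open>E u v = 1\<close>, the coefficient at \<open>u\<close> must be set to
  0 separately to keep the change of basis invertible.\<close>
proof (rule nullity_congruence[where u = u and c = "\<lambda>x. if x = u then 0 else E x v"])
  fix x y assume "x \<in> insert u S" "y \<in> insert u S"
  then show "F x y = E x y + (if x = u then 0 else E x v) * E u y + E x u * (if y = u then 0 else E y v)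
      + (if x = u then 0 else E x v) * (if y = u then 0 else E y v) * E u u"
    using notin diag F_u F_E E_comm F_comm
    by (auto simp: ac_simps)
qed (use fin in auto)

end

section \<open>State sums\<close>

lemma a_pow_mult [simp]: "a_pow i * a_pow j = a_pow (i + j)"
  by (simp add: a_pow_def mult_single)

lemma a_pow_0: "a_pow 0 = 1"
  by (simp add: a_pow_def)

lemma a_pow_mult_left [simp]: "a_pow i * (a_pow j * p) = a_pow (i + j) * p"
  by (simp flip: mult.assoc)

text \<open>For labels 1 and -1 this is alpha minus beta, written vertex by vertex so that the
  vertices named in a move can be split off.\<close>

definition state_weight :: "'v set \<Rightarrow> ('v \<Rightarrow> int) \<Rightarrow> 'v set \<Rightarrow> int" where
  "state_weight V l s = (\<Sum>x\<in>V. if x \<in> s then - l x else l x)"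

text \<open>With \<open>g\<close> arbitrary, splitting off a vertex gives a sum of the same shape,
  so the step can be repeated.\<close>

definition state_sum :: "'v set \<Rightarrow> ('v \<Rightarrow> int) \<Rightarrow> ('v set \<Rightarrow> laurent) \<Rightarrow> laurent" where
  "state_sum V l g = (\<Sum>s\<in>Pow V. a_pow (state_weight V l s) * g s)"

text \<open>States either avoid or contain \<open>u\<close>. Repeated use collects all states with
  the same trace on the unnamed vertices, which reduces each move to an identity for a fixed
  trace.\<close>

lemma state_sum_insert:
  assumes fin: "finite V" and u: "u \<notin> V"
  shows "state_sum (insert u V) l g =
    state_sum V l (\<lambda>s. a_pow (l u) * g s + a_pow (- l u) * g (insert u s))"
proof -
  have out: "state_weight (insert u V) l s = l u + state_weight V l s" if "s \<in> Pow V" for s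
    using fin u that by (auto simp: state_weight_def)
  have into: "state_weight (insert u V) l (insert u s) = - l u + state_weight V l s" if "s \<in> Pow V" for s
  proof -
    have "(\<Sum>x\<in>V. if x \<in> insert u s then - l x else l x) = state_weight V l s"
      unfolding state_weight_def using u by (intro sum.cong) auto
    then show ?thesis
      using fin u by (simp add: state_weight_def)
  qed
  have "inj_on (insert u) (Pow V)"
    using u by (auto simp: inj_on_def insert_eq_iff)
  moreover have "Pow V \<inter> insert u ` Pow V = {}"
    using u by auto
  ultimately have "state_sum (insert u V) l g =
      (\<Sum>s\<in>Pow V. a_pow (state_weight (insert u V) l s) * g s)
      + (\<Sum>s\<in>Pow V. a_pow (state_weight (insert u V) l (insert u s)) * g (insert u s))"
    unfolding state_sum_def Pow_insert using fin by (subst sum.union_disjoint) (auto simp: sum.reindex)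
  also have "\<dots> = (\<Sum>s\<in>Pow V. a_pow (l u + state_weight V l s) * g s)
      + (\<Sum>s\<in>Pow V. a_pow (- l u + state_weight V l s) * g (insert u s))"
    by (simp only: out into cong: sum.cong)
  also have "\<dots> = state_sum V l (\<lambda>s. a_pow (l u) * g s + a_pow (- l u) * g (insert u s))"
    unfolding state_sum_def sum.distrib[symmetric]
    by (intro sum.cong refl) (simp add: distrib_left add.commute)
  finally show ?thesis .
qed

lemma state_sum_cong:
  assumes "\<And>x. x \<in> V \<Longrightarrow> l x = m x" and "\<And>s. s \<subseteq> V \<Longrightarrow> g s = h s"
  shows "state_sum V l g = state_sum V m h"
proof -
  have "state_weight V l s = state_weight V m s" for s
    unfolding state_weight_def using assms(1) by (intro sum.cong) auto
  then show ?thesis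
    unfolding state_sum_def using assms(2) by (intro sum.cong) auto
qed

section \<open>The bracket as a state sum, and its behaviour under the three moves\<close>

definition loop_value :: laurent where
  "loop_value = - a_pow 2 - a_pow (- 2)"

definition bracket :: "'v set \<Rightarrow> ('v \<Rightarrow> int) \<Rightarrow> ('v \<Rightarrow> 'v \<Rightarrow> bit) \<Rightarrow> laurent" where
  "bracket V l E = state_sum V l (\<lambda>s. loop_value ^ nullity E s)"

text \<open>Opposite labels give total exponent 0 if neither or both twins are in the state, and 2
  or -2 if exactly one is. The three terms containing a twin cancel by the choice of
  \<open>loop_value\<close>.\<close>

lemma bracket_remove_twins:
  assumes "finite V" "u \<noteq> v" "u \<notin> V" "v \<notin> V"
    and "E u u = 0" "E v v = 0" "E u v = 0" "E v u = 0"
    and "\<And>x. x \<in> V \<Longrightarrow> E u x = E v x" "\<And>x. x \<in> V \<Longrightarrow> E x u = E x v"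
    and l: "l u = 1 \<or> l u = - 1" "l v = - l u"
  shows "bracket (insert u (insert v V)) l E = bracket V l E"
proof -
  have "a_pow (l v) * (a_pow (l u) * loop_value ^ nullity E s
        + a_pow (- l u) * loop_value ^ nullity E (insert u s))
      + a_pow (- l v) * (a_pow (l u) * loop_value ^ nullity E (insert v s)
        + a_pow (- l u) * loop_value ^ nullity E (insert u (insert v s)))
      = loop_value ^ nullity E s" if s: "s \<subseteq> V" for s
  proof -
    have fin: "finite s" and notin: "u \<notin> s" "v \<notin> s"
      using assms s finite_subset by auto
    define p where "p = loop_value ^ nullity E (insert v s)"
    have "nullity E (insert u (insert v s)) = Suc (nullity E (insert v s))"
      using assms s fin notin by (intro nullity_twins) auto
    then have uv: "loop_value ^ nullity E (insert u (insert v s)) = loop_value * p"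
      by (simp add: p_def)
    have "nullity E (insert u s) = nullity E (insert v s)"
      using assms s fin notin by (intro nullity_swap_twins) auto
    then have u: "loop_value ^ nullity E (insert u s) = p"
      by (simp add: p_def)
    have v: "loop_value ^ nullity E (insert v s) = p"
      by (simp add: p_def)
    have "loop_value * p = - (a_pow 2 * p) - a_pow (- 2) * p"
      by (simp add: loop_value_def left_diff_distrib)
    then show ?thesis
      unfolding u v uv using l by (auto simp: distrib_left a_pow_0)
  qed
  then show ?thesis
    unfolding bracket_def using assms
    by (simp add: state_sum_insert) (intro state_sum_cong; simp)
qed

text \<open>For a fixed trace \<open>s\<close>, states adding only \<open>v\<close> or only
  \<open>w\<close> match directly, and \<open>suvw\<close> before matches \<open>su\<close> after.
  Before the move, \<open>s\<close>, \<open>su\<close>, \<open>suv\<close>, \<open>suw\<close> give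
  \<open>(a^-3 + d*a^-1 + 2*a) * p = a*p\<close>, the term of \<open>s\<close> afterwards. Likewise
  \<open>svw\<close>, \<open>suvw\<close>, \<open>suv\<close>, \<open>suw\<close> after the move
  give \<open>a*q\<close>, the term of \<open>svw\<close> before it.\<close>

lemma bracket_triangle_move:
  assumes fin: "finite V"
    and notin: "u \<notin> V" "v \<notin> V" "w \<notin> V" and distinct: "u \<noteq> v" "u \<noteq> w" "v \<noteq> w"
    and sym: "\<And>x y. E x y = E y x" "\<And>x y. F x y = F y x"
    and diag: "\<And>x. E x x = 0" "\<And>x. F x x = 0"
    and E_u: "E u v = 1" "E u w = 1" "\<And>x. x \<in> V \<Longrightarrow> E u x = 0"
    and F_u: "\<And>x. x \<in> insert v (insert w V) \<Longrightarrow> F u x = E v x + E w x"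
    and F_E: "\<And>x y. x \<in> insert v (insert w V) \<Longrightarrow> y \<in> insert v (insert w V) \<Longrightarrow> F x y = E x y"
    and l: "l u = - 1" "l v = - 1" "l w = - 1"
    and m: "m u = - 1" "m v = 1" "m w = 1" "\<And>x. x \<in> V \<Longrightarrow> m x = l x"
  shows "bracket (insert u (insert v (insert w V))) m F = bracket (insert u (insert v (insert w V))) l E"
proof -
  let ?e = "\<lambda>s. loop_value ^ nullity E s" and ?f = "\<lambda>s. loop_value ^ nullity F s"
  have "a_pow 1 * (a_pow 1 * (a_pow (- 1) * ?f s + a_pow 1 * ?f (insert u s))
        + a_pow (- 1) * (a_pow (- 1) * ?f (insert v s) + a_pow 1 * ?f (insert u (insert v s))))
      + a_pow (- 1) * (a_pow 1 * (a_pow (- 1) * ?f (insert w s) + a_pow 1 * ?f (insert u (insert w s)))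
        + a_pow (- 1) * (a_pow (- 1) * ?f (insert v (insert w s)) + a_pow 1 * ?f (insert u (insert v (insert w s)))))
      = a_pow (- 1) * (a_pow (- 1) * (a_pow (- 1) * ?e s + a_pow 1 * ?e (insert u s))
        + a_pow 1 * (a_pow (- 1) * ?e (insert v s) + a_pow 1 * ?e (insert u (insert v s))))
      + a_pow 1 * (a_pow (- 1) * (a_pow (- 1) * ?e (insert w s) + a_pow 1 * ?e (insert u (insert w s)))
        + a_pow 1 * (a_pow (- 1) * ?e (insert v (insert w s)) + a_pow 1 * ?e (insert u (insert v (insert w s)))))"
    (is "?lhs = ?rhs") if s: "s \<subseteq> V" for s
  proof -
    have fins: "finite s" and notins: "u \<notin> s" "v \<notin> s" "w \<notin> s"
      using fin notin s finite_subset by auto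
    have E_us: "\<And>x. x \<in> s \<Longrightarrow> E u x = 0"
      and F_us: "\<And>x. x \<in> insert v (insert w s) \<Longrightarrow> F u x = E v x + E w x"
      and F_us': "\<And>x. x \<in> insert w (insert v s) \<Longrightarrow> F u x = E w x + E v x"
      and F_Es: "\<And>x y. x \<in> insert v (insert w s) \<Longrightarrow> y \<in> insert v (insert w s) \<Longrightarrow> F x y = E x y"
      and F_Es': "\<And>x y. x \<in> insert w (insert v s) \<Longrightarrow> y \<in> insert w (insert v s) \<Longrightarrow> F x y = E x y"
      using s E_u F_u F_E by (auto simp: add.commute subset_iff)
    note hyps = fins notins distinct sym diag E_u(1,2) E_us F_us F_Es
    \<comment> \<open>The move is symmetric in \<open>v\<close> and \<open>w\<close>; the exchanged
      hypotheses serve the states containing \<open>u\<close> and \<open>w\<close> but not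
      \<open>v\<close>.\<close>
    note hyps' = fins notins(1,3,2) distinct(2,1) distinct(3)[symmetric] sym diag E_u(2,1) E_us F_us' F_Es'
    have E_nullity: "nullity E (insert u s) = Suc (nullity E s)"
      "nullity E (insert u (insert v s)) = nullity E s"
      "nullity E (insert u (insert w s)) = nullity E s"
      "nullity E (insert u (insert v (insert w s))) = nullity F (insert u s)"
      by (rule triangle_E_u[OF hyps] triangle_E_uv[OF hyps] triangle_E_uv[OF hyps'] triangle_E_uvw[OF hyps];
          assumption)+
    have F_nullity: "nullity F (insert u (insert v s)) = nullity E (insert v (insert w s))"
      "nullity F (insert u (insert w s)) = nullity E (insert w (insert v s))"
      "nullity F (insert u (insert v (insert w s))) = Suc (nullity E (insert v (insert w s)))"
      by (rule triangle_F_uv[OF hyps] triangle_F_uv[OF hyps'] triangle_F_uvw[OF hyps]; assumption)+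
    \<comment> \<open>Only pairs containing \<open>u\<close> change, so states without
      \<open>u\<close> keep their corank.\<close>
    have same: "nullity F t = nullity E t" if t: "t \<subseteq> insert v (insert w s)" for t
      by (rule nullity_cong[OF finite_subset[OF t]], simp add: fins, rule F_Es; erule subsetD[OF t])
    define p q r where "p = ?e s" and "q = ?e (insert v (insert w s))" and "r = ?f (insert u s)"
    have p: "loop_value * p = - (a_pow 2 * p) - a_pow (- 2) * p" for p
      by (simp add: loop_value_def left_diff_distrib)
    have F: "?f s = p" "?f (insert v s) = ?e (insert v s)" "?f (insert w s) = ?e (insert w s)"
      "?f (insert v (insert w s)) = q"
      unfolding p_def q_def by (subst same; blast)+
    have uvw: "?f (insert u (insert v s)) = q" "?f (insert u (insert w s)) = q"
      "?f (insert u (insert v (insert w s))) = loop_value * q"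
      unfolding q_def F_nullity by (simp_all add: insert_commute)
    have E: "?e (insert u s) = loop_value * p" "?e (insert u (insert v s)) = p"
      "?e (insert u (insert w s)) = p" "?e (insert u (insert v (insert w s))) = r"
      unfolding p_def r_def E_nullity by simp_all
    note vals = F uvw E p_def[symmetric] q_def[symmetric] r_def[symmetric]
    show ?thesis
      unfolding vals p by (simp add: distrib_left right_diff_distrib)
  qed
  then show ?thesis
    unfolding bracket_def using fin notin distinct l m
    by (simp add: state_sum_insert) (intro state_sum_cong; simp)
qed

text \<open>The relabeling makes exponents follow coranks: the state with neither vertex and the
  state with both exchange their exponents \<open>l u + l v\<close> and \<open>- l u - l v\<close>,
  while a state with exactly one of them keeps its exponent.\<close>

lemma bracket_pivot_move:
  assumes fin: "finite V" and notin: "u \<notin> V" "v \<notin> V" and distinct: "u \<noteq> v"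
    and sym: "\<And>x y. E x y = E y x" "\<And>x y. F x y = F y x"
    and diag: "\<And>x. E x x = 0" "\<And>x. F x x = 0"
    and E_uv: "E u v = 1"
    and F_u: "\<And>x. x \<in> insert v V \<Longrightarrow> F u x = E u x"
    and F_v: "\<And>x. x \<in> insert u V \<Longrightarrow> F v x = E v x"
    and F_E: "\<And>x y. x \<in> V \<Longrightarrow> y \<in> V \<Longrightarrow> F x y = E x y + E x u * E v y + E x v * E u y"
    and m: "m u = - l v" "m v = - l u" "\<And>x. x \<in> V \<Longrightarrow> m x = l x"
  shows "bracket (insert u (insert v V)) m F = bracket (insert u (insert v V)) l E"
proof -
  let ?e = "\<lambda>s. loop_value ^ nullity E s" and ?f = "\<lambda>s. loop_value ^ nullity F s"
  have "a_pow (- l u) * (a_pow (- l v) * ?f s + a_pow (l v) * ?f (insert u s))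
      + a_pow (l u) * (a_pow (- l v) * ?f (insert v s) + a_pow (l v) * ?f (insert u (insert v s)))
      = a_pow (l v) * (a_pow (l u) * ?e s + a_pow (- l u) * ?e (insert u s))
      + a_pow (- l v) * (a_pow (l u) * ?e (insert v s) + a_pow (- l u) * ?e (insert u (insert v s)))"
    if s: "s \<subseteq> V" for s
  proof -
    have fins: "finite s" and notins: "u \<notin> s" "v \<notin> s"
      using fin notin s finite_subset by auto
    have F_us: "\<And>x. x \<in> insert v s \<Longrightarrow> F u x = E u x"
      and F_vs: "\<And>x. x \<in> insert u s \<Longrightarrow> F v x = E v x"
      and F_Es: "\<And>x y. x \<in> s \<Longrightarrow> y \<in> s \<Longrightarrow> F x y = E x y + E x u * E v y + E x v * E u y"
      and F_Es': "\<And>x y. x \<in> s \<Longrightarrow> y \<in> s \<Longrightarrow> F x y = E x y + E x v * E u y + E x u * E v y"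
      using s F_u F_v F_E by (auto simp: ac_simps subset_iff)
    have E_vu: "E v u = 1"
      using E_uv sym(1) by simp
    note hyps = fins notins distinct sym diag E_uv F_us F_vs F_Es
    note hyps' = fins notins(2,1) distinct[symmetric] sym diag E_vu F_vs F_us F_Es'
    have nullity_F: "nullity F s = nullity E (insert u (insert v s))"
      "nullity F (insert u s) = nullity E (insert u s)"
      "nullity F (insert v s) = nullity E (insert v s)"
      "nullity F (insert u (insert v s)) = nullity E s"
      by (rule pivot_E_uv[OF hyps, symmetric] pivot_u[OF hyps] pivot_u[OF hyps'] pivot_F_uv[OF hyps];
          assumption)+
    show ?thesis
      unfolding nullity_F by (simp add: distrib_left add.commute add.left_commute)
  qed
  then show ?thesis
    unfolding bracket_def using fin notin distinct m
    by (simp add: state_sum_insert) (intro state_sum_cong; simp)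
qed

section \<open>Labeled graphs\<close>

definition adjacent :: "'v lgraph \<Rightarrow> 'v \<Rightarrow> 'v \<Rightarrow> bit" where
  "adjacent G x y = (if {x, y} \<in> edges G then 1 else 0)"

lemma adjacent_commute: "adjacent G x y = adjacent G y x"
  by (simp add: adjacent_def insert_commute)

text \<open>The pair \<open>{x, x}\<close> collapses to a singleton, and edges have two distinct
  ends.\<close>

lemma adjacent_self:
  assumes "labeled_graph G"
  shows "adjacent G x x = 0"
proof -
  have "{x} \<notin> edges G"
    using assms by (auto simp: labeled_graph_def doubleton_eq_iff subset_iff)
  then show ?thesis by (simp add: adjacent_def)
qed

lemma corank_induced:
  assumes "finite s"
  shows "corank (adjacency_matrix (induced G s)) = nullity (adjacent G) s"
proof -
  define xs where "xs = (SOME xs. distinct xs \<and> set xs = s)"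
  have "set xs = s"
    unfolding xs_def using finite_distinct_list[OF assms]
    by (intro someI_ex[where P = "\<lambda>xs. distinct xs \<and> set xs = s", THEN conjunct2])
      (elim exE conjE, intro exI conjI)
  \<comment> \<open>All listed vertices lie in \<open>s\<close>, so an edge of \<open>G\<close>
    between two of them survives in \<open>induced G s\<close>.\<close>
  then have "xs ! i \<in> s" if "i < length xs" for i
    using that by auto
  then have "mat (length xs) (length xs) (\<lambda>(i, j). if {xs ! i, xs ! j} \<in> edges (induced G s) then 1 else 0)
      = mat (length xs) (length xs) (\<lambda>(i, j). adjacent G (xs ! i) (xs ! j))"
    by (intro eq_matI) (simp_all add: induced_def adjacent_def)
  then show ?thesis
    by (simp add: adjacency_matrix_def nullity_def xs_def Let_def induced_def)
qed

text \<open>The difference equals \<open>2 * alpha - n\<close>: a vertex contributes 1 if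
  \<open>alpha\<close> counts it and -1 otherwise, which is its label with the sign reversed inside
  \<open>s\<close>.\<close>

lemma alpha_minus_beta:
  assumes G: "labeled_graph G" and s: "s \<subseteq> verts G"
  shows "alpha G s - beta G s = state_weight (verts G) (label G) s"
proof -
  let ?V = "verts G"
  have fin: "finite ?V" and lab: "\<And>x. x \<in> ?V \<Longrightarrow> label G x = 1 \<or> label G x = - 1"
    using G by (auto simp: labeled_graph_def)
  let ?A = "{x \<in> ?V. if x \<in> s then label G x = - 1 else label G x = 1}"
  have "?A = {x \<in> s. label G x = - 1} \<union> {x \<in> ?V - s. label G x = 1}"
    using s by auto
  then have "card ?A = card {x \<in> s. label G x = - 1} + card {x \<in> ?V - s. label G x = 1}"
    using fin finite_subset[OF s] by (simp add: card_Un_disjoint disjoint_iff)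
  then have "alpha G s = int (card ?A)"
    by (simp add: alpha_def)
  also have "\<dots> = (\<Sum>x\<in>?V. of_bool (if x \<in> s then label G x = - 1 else label G x = 1))"
    using fin by (simp add: sum_of_bool_eq Int_def)
  finally have "alpha G s - beta G s =
      (\<Sum>x\<in>?V. 2 * of_bool (if x \<in> s then label G x = - 1 else label G x = 1) - 1)"
    by (simp add: beta_def sum_subtractf sum_distrib_left)
  also have "\<dots> = state_weight ?V (label G) s"
    unfolding state_weight_def using lab by (intro sum.cong) auto
  finally show ?thesis .
qed

lemma kauffman_bracket_eq:
  assumes G: "labeled_graph G"
  shows "kauffman_bracket G = bracket (verts G) (label G) (adjacent G)"
  unfolding kauffman_bracket_def bracket_def state_sum_def loop_value_def
proof (intro sum.cong refl)
  fix s assume "s \<in> Pow (verts G)"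
  moreover have "finite (verts G)"
    using G by (simp add: labeled_graph_def)
  ultimately show "a_pow (alpha G s - beta G s) * (- a_pow 2 - a_pow (- 2)) ^ corank (adjacency_matrix (induced G s))
      = a_pow (state_weight (verts G) (label G) s) * (- a_pow 2 - a_pow (- 2)) ^ nullity (adjacent G) s"
    using finite_subset[of s "verts G"] by (simp add: alpha_minus_beta[OF G] corank_induced)
qed

section \<open>Translation of the graph moves into conditions on adjacency and labels\<close>

lemma bracket_cong:
  assumes "finite V" and "\<And>x. x \<in> V \<Longrightarrow> l x = m x"
    and "\<And>x y. x \<in> V \<Longrightarrow> y \<in> V \<Longrightarrow> E x y = F x y"
  shows "bracket V l E = bracket V m F"
proof -
  have "nullity E s = nullity F s" if "s \<subseteq> V" for s
    using assms(3) that by (intro nullity_cong finite_subset[OF that assms(1)]) (simp add: subset_iff)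
  then show ?thesis
    unfolding bracket_def using assms(2) by (intro state_sum_cong) auto
qed

lemma kauffman_bracket_omega2_removal:
  assumes G: "labeled_graph G" and H: "labeled_graph H" and move: "omega2_removal G H"
  shows "kauffman_bracket H = kauffman_bracket G"
proof -
  obtain u v where uv: "u \<in> verts G" "v \<in> verts G" "u \<noteq> v" "{u, v} \<notin> edges G"
      "label G u = - label G v"
      "\<forall>t\<in>verts G - {u, v}. {u, t} \<in> edges G \<longleftrightarrow> {v, t} \<in> edges G"
    and verts_H: "verts H = verts G - {u, v}"
    and edges_H: "edges H = {e \<in> edges G. e \<subseteq> verts H}"
    and label_H: "\<forall>x\<in>verts H. label H x = label G x"
    using move unfolding omega2_removal_def by (elim bexE conjE) (rule that)
  have fin: "finite (verts H)"
    using H by (simp add: labeled_graph_def)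
  have verts_G: "verts G = insert u (insert v (verts H))"
    using uv(1,2) verts_H by auto
  have twins: "adjacent G u x = adjacent G v x" if "x \<in> verts H" for x
    using uv(6) that by (simp add: adjacent_def verts_H)
  \<comment> \<open>The twins are removed with the data of \<open>G\<close> kept; on the remaining
    vertices these agree with the data of \<open>H\<close>.\<close>
  have "bracket (verts G) (label G) (adjacent G) = bracket (verts H) (label G) (adjacent G)"
    unfolding verts_G
  proof (rule bracket_remove_twins)
    show "label G u = 1 \<or> label G u = - 1" "label G v = - label G u"
      using G uv(1,5) by (auto simp: labeled_graph_def)
    show "adjacent G u v = 0" "adjacent G v u = 0"
      using uv(4) by (simp_all add: adjacent_def insert_commute)
    show "adjacent G x u = adjacent G x v" if "x \<in> verts H" for x
      using twins[OF that] adjacent_commute[of G x u] adjacent_commute[of G x v] by argo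
  qed (use fin uv(3) verts_H adjacent_self[OF G] twins in auto)
  also have "\<dots> = bracket (verts H) (label H) (adjacent H)"
    using fin label_H by (intro bracket_cong) (auto simp: adjacent_def edges_H)
  finally show ?thesis
    by (simp add: kauffman_bracket_eq G H)
qed

lemma kauffman_bracket_omega3_forward:
  assumes G: "labeled_graph G" and H: "labeled_graph H" and move: "omega3_forward G H"
  shows "kauffman_bracket H = kauffman_bracket G"
proof -
  obtain u v w where uvw: "u \<in> verts G" "v \<in> verts G" "w \<in> verts G"
      "u \<noteq> v" "u \<noteq> w" "v \<noteq> w"
      "label G u = - 1" "label G v = - 1" "label G w = - 1"
    and nbhd_u: "nbhd G u = {v, w}" and verts_H: "verts H = verts G"
    and edges_H: "edges H = change_adjacency (edges G)
          {{u, t} | t. t \<in> (closed_nbhd G v - closed_nbhd G w) \<union> (closed_nbhd G w - closed_nbhd G v)}"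
    and label_H: "\<forall>x\<in>verts G. label H x = (if x = v \<or> x = w then 1 else label G x)"
    using move unfolding omega3_forward_def by (elim bexE conjE) (rule that)
  define V where "V = verts G - {u, v, w}"
  have fin: "finite V" and notin: "u \<notin> V" "v \<notin> V" "w \<notin> V"
    using G by (auto simp: labeled_graph_def V_def)
  have verts_G: "verts G = insert u (insert v (insert w V))"
    using uvw(1-3) by (auto simp: V_def)
  have edge_u: "{u, x} \<in> edges G \<longleftrightarrow> x = v \<or> x = w" for x
    using nbhd_u by (auto simp: nbhd_def)
  \<comment> \<open>At \<open>x = v\<close> the closed neighbourhoods flip the edge
    \<open>uv\<close> exactly when \<open>v\<close> and \<open>w\<close> are not adjacent, so it
    survives exactly when they are; likewise at \<open>x = w\<close>.\<close>
  have edge_uH: "{u, x} \<in> edges H \<longleftrightarrow> (({v, x} \<in> edges G) \<noteq> ({w, x} \<in> edges G))"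
    if "x \<in> insert v (insert w V)" for x
  proof -
    have "{v} \<notin> edges G" "{w} \<notin> edges G" "{w, v} = {v, w}"
      using adjacent_self[OF G, of v] adjacent_self[OF G, of w] by (auto simp: adjacent_def)
    moreover have "{u, x} \<in> {{u, t} | t. P t} \<longleftrightarrow> P x" for P
      by (auto simp: doubleton_eq_iff)
    then have "{u, x} \<in> edges H \<longleftrightarrow>
        (x = v \<or> x = w) \<noteq> ((x = v \<or> {v, x} \<in> edges G) \<noteq> (x = w \<or> {w, x} \<in> edges G))"
      unfolding edges_H change_adjacency_def
      by (simp add: edge_u closed_nbhd_def nbhd_def) blast
    ultimately show ?thesis
      using uvw(6) by (cases "x = v"; cases "x = w") simp_all
  qed
  have edge_H: "{x, y} \<in> edges H \<longleftrightarrow> {x, y} \<in> edges G"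
    if "x \<in> insert v (insert w V)" "y \<in> insert v (insert w V)" for x y
  proof -
    have "{x, y} \<notin> {{u, t} | t. P t}" for P
      using that notin uvw(4,5) by (auto simp: doubleton_eq_iff)
    then show ?thesis
      unfolding edges_H change_adjacency_def Un_iff Diff_iff by blast
  qed
  have "bracket (verts G) (label H) (adjacent H) = bracket (verts G) (label G) (adjacent G)"
    unfolding verts_G
  proof (rule bracket_triangle_move)
    show "adjacent H u x = adjacent G v x + adjacent G w x" if "x \<in> insert v (insert w V)" for x
      using edge_uH[OF that] by (simp add: adjacent_def)
    show "adjacent H x y = adjacent G x y"
      if "x \<in> insert v (insert w V)" "y \<in> insert v (insert w V)" for x y
      using edge_H[OF that] by (simp add: adjacent_def)
    show "adjacent G u v = 1" "adjacent G u w = 1" "\<And>x. x \<in> V \<Longrightarrow> adjacent G u x = 0"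
      using notin by (auto simp: adjacent_def edge_u)
    show "label H u = - 1" "label H v = 1" "label H w = 1"
      using uvw label_H by simp_all
    show "label H x = label G x" if "x \<in> V" for x
      using that label_H notin by (auto simp: V_def)
  qed (fact fin notin uvw adjacent_commute adjacent_self[OF G] adjacent_self[OF H])+
  then show ?thesis
    by (simp add: kauffman_bracket_eq G H verts_H)
qed

lemma kauffman_bracket_omega4:
  assumes G: "labeled_graph G" and H: "labeled_graph H" and move: "omega4 G H"
  shows "kauffman_bracket H = kauffman_bracket G"
proof -
  obtain u v where uv: "u \<in> verts G" "v \<in> verts G" "u \<noteq> v" "{u, v} \<in> edges G"
    and verts_H: "verts H = verts G"
    and edges_H: "edges H = change_adjacency (edges G)
          {{t, w} | t w. t \<in> verts G - {u, v} \<and> w \<in> verts G - {u, v} \<and>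
             (t \<in> nbhd G u \<and> w \<in> nbhd G v - nbhd G u \<or>
              t \<in> nbhd G v \<and> w \<in> nbhd G u - nbhd G v)}"
    and label_H: "\<forall>x\<in>verts G. label H x =
           (if x = u then - label G v else if x = v then - label G u else label G x)"
    using move unfolding omega4_def by (elim bexE conjE) (rule that)
  define V where "V = verts G - {u, v}"
  have fin: "finite V" and notin: "u \<notin> V" "v \<notin> V"
    using G by (auto simp: labeled_graph_def V_def)
  have verts_G: "verts G = insert u (insert v V)"
    using uv(1,2) by (auto simp: V_def)
  define P where "P t w \<longleftrightarrow> t \<in> nbhd G u \<and> w \<in> nbhd G v - nbhd G u \<or>
      t \<in> nbhd G v \<and> w \<in> nbhd G u - nbhd G v" for t w
  have edges_H': "edges H = change_adjacency (edges G) {{t, w} | t w. t \<in> V \<and> w \<in> V \<and> P t w}"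
    unfolding edges_H V_def P_def ..
  \<comment> \<open>All changed pairs lie in \<open>V\<close>, so the rows of \<open>u\<close> and
    \<open>v\<close> survive the move.\<close>
  have edge_uv: "{x, y} \<in> edges H \<longleftrightarrow> {x, y} \<in> edges G" if "x = u \<or> x = v" for x y
    using that notin unfolding edges_H' change_adjacency_def by (auto simp: doubleton_eq_iff)
  have edge_V: "{x, y} \<in> edges H \<longleftrightarrow> (({x, y} \<in> edges G) \<noteq> (P x y \<or> P y x))"
    if "x \<in> V" "y \<in> V" for x y
  proof -
    \<comment> \<open>Pairs are unordered while \<open>P\<close> is not symmetric, so both orders
      have to be considered.\<close>
    have "{x, y} \<in> {{t, w} | t w. t \<in> V \<and> w \<in> V \<and> P t w} \<longleftrightarrow> P x y \<or> P y x"
      using that by (auto simp: doubleton_eq_iff)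
    then show ?thesis
      unfolding edges_H' change_adjacency_def by blast
  qed
  have "bracket (verts G) (label H) (adjacent H) = bracket (verts G) (label G) (adjacent G)"
    unfolding verts_G
  proof (rule bracket_pivot_move)
    \<comment> \<open>\<open>P x y \<or> P y x\<close> holds exactly when one and only one of the
      two products is 1, that is, when their sum over \<open>bit\<close> is 1.\<close>
    show "adjacent H x y = adjacent G x y + adjacent G x u * adjacent G v y + adjacent G x v * adjacent G u y"
      if "x \<in> V" "y \<in> V" for x y
      unfolding adjacent_commute[of G x u] adjacent_commute[of G x v]
      using edge_V[OF that] by (simp add: adjacent_def P_def nbhd_def)
    show "adjacent G u v = 1"
      using uv(4) by (simp add: adjacent_def)
    show "adjacent H u x = adjacent G u x" "adjacent H v x = adjacent G v x" for x
      by (simp_all add: adjacent_def edge_uv)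
    show "label H u = - label G v" "label H v = - label G u"
      using uv label_H by simp_all
    show "label H x = label G x" if "x \<in> V" for x
      using that label_H notin by (auto simp: V_def)
  qed (fact fin notin uv adjacent_commute adjacent_self[OF G] adjacent_self[OF H])+
  then show ?thesis
    by (simp add: kauffman_bracket_eq G H verts_H)
qed

theorem theorem4p2:
  fixes G H :: "'v lgraph"
  assumes "labeled_graph G" and "labeled_graph H"
    and "omega2 G H \<or> omega3 G H \<or> omega4 G H"
  shows "kauffman_bracket H = kauffman_bracket G"
  \<comment> \<open>The second and third moves include their inverses, hence the use of their lemmas
    with \<open>G\<close> and \<open>H\<close> exchanged as well.\<close>
  using assms kauffman_bracket_omega2_removal[of G H] kauffman_bracket_omega2_removal[of H G]
    kauffman_bracket_omega3_forward[of G H] kauffman_bracket_omega3_forward[of H G]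
    kauffman_bracket_omega4[of G H]
  unfolding omega2_def omega3_def by argo

end
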